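(* Let $n\ge 1$ and let $S\subseteq \mathbb{S}^{n-1}$ be a Borel subset of the unit hyper-sphere in $\mathbb{R}^n$ such that $\dim_B S\equiv \delta\geq 0$. For every $\alpha>0$, the $\alpha$-regular fractal nest of outer type $\mathcal{O}_\alpha S=\bigcup_{k=1}^\infty (1-k^{-\alpha})S$ satisfies $$\dim_B \mathcal{O}_\alpha S\equiv \delta+\frac1{\alpha+1}.$$
   Context: For $S\subseteq\mathbb{R}^n$ and $x\ge 0$, $(x)S=\{xs : s\in S\}$ is the scaling of $S$ by $x$. For $\epsilon>0$, $(S)_\epsilon=\{x\in\mathbb{R}^n : d(x,S)\le\epsilon\}$ (Euclidean distance), and $\lambda$ is Lebesgue measure on $\mathbb{R}^n$. For a bounded Borel set $S\subseteq\mathbb{R}^n$, $N_\epsilon(S)$ is the number of cubes of the $\epsilon$-mesh of $\mathbb{R}^n$ (the partition of $\mathbb{R}^n$ into $n$-cubes of side $\epsilon$, disjoint except possibly at the border) that intersect $S$. The upper and lower box counting dimensions are $\overline{\dim}_B S=\inf\{\delta\in\mathbb{R} : \epsilon^\delta N_\epsilon(S)\to 0 \text{ as }\epsilon\to0\}$ and $\underline{\dim}_B S=\sup\{\delta\in\mathbb{R} : \epsilon^\delta N_\epsilon(S)\to +\infty\text{ as }\epsilon\to0\}$. Write $\dim_B S=d$ if $\overline{\dim}_B S=\underline{\dim}_B S=d$. Let $\gamma_x=\frac{\pi^{x/2}}{\Gamma(x/2+1)}$ and $A^{n,d}_\epsilon(S)=\frac{\lambda\left((S)_\epsilon\right)}{\gamma_{n-d}\,\epsilon^{n-d}}$.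 For $S$ with $\dim_B S=d$, the normalised upper and lower Minkowski contents are $\mathcal{M}^*_d(S)=\limsup_{\epsilon\to0}A^{n,d}_\epsilon(S)$ and $\mathcal{M}_{*d}(S)=\liminf_{\epsilon\to0}A^{n,d}_\epsilon(S)$. The notation $\dim_B S\equiv d$ means that $\dim_B S=d$ and $S$ is Minkowski-non-degenerate, i.e. $\mathcal{M}^*_d(S)<+\infty$ and $\mathcal{M}_{*d}(S)>0$. *)

theory Defs
  imports "HOL-Analysis.Analysis"
begin

text \<open>The Euclidean space of dimension n is \<open>real ^ 'n\<close> with n = \<open>CARD('n)\<close>, and the limit
  as eps tends to 0 (through positive values) is taken along \<open>at_right 0\<close>.\<close>

definition scaling :: "real \<Rightarrow> (real ^ 'n) set \<Rightarrow> (real ^ 'n) set" where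
  "scaling x S = (\<lambda>s. x *\<^sub>R s) ` S"

text \<open>The conjunct \<open>S \<noteq> {}\<close> only overrides the library convention \<open>infdist x {} = 0\<close>: the
  distance to the empty set is meant to be infinite, so its neighbourhoods are empty.\<close>

definition nbhd :: "real \<Rightarrow> (real ^ 'n) set \<Rightarrow> (real ^ 'n) set" where
  "nbhd \<epsilon> S = {x. S \<noteq> {} \<and> infdist x S \<le> \<epsilon>}"

text \<open>The mesh consists of closed cubes, with one cube having the origin as its lowest corner.\<close>

definition mesh :: "real \<Rightarrow> (real ^ 'n) set set" where
  "mesh \<epsilon> = {cbox (\<chi> i. \<epsilon> * of_int (m i)) (\<chi> i. \<epsilon> * (of_int (m i) + 1)) | m :: 'n \<Rightarrow> int. True}"

definition box_count :: "real \<Rightarrow> (real ^ 'n) set \<Rightarrow> nat" where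
  "box_count \<epsilon> S = card {Q \<in> mesh \<epsilon>. Q \<inter> S \<noteq> {}}"

text \<open>The infimum and supremum range over real exponents but are taken in the extended reals; both
  dimensions of the empty set are minus infinity.\<close>

definition upper_box_dim :: "(real ^ 'n) set \<Rightarrow> ereal" where
  "upper_box_dim S =
     Inf (ereal ` {\<delta>. ((\<lambda>\<epsilon>. \<epsilon> powr \<delta> * real (box_count \<epsilon> S)) \<longlongrightarrow> 0) (at_right 0)})"

definition lower_box_dim :: "(real ^ 'n) set \<Rightarrow> ereal" where
  "lower_box_dim S =
     Sup (ereal ` {\<delta>. filterlim (\<lambda>\<epsilon>. \<epsilon> powr \<delta> * real (box_count \<epsilon> S)) at_top (at_right 0)})"

definition has_box_dim :: "(real ^ 'n) set \<Rightarrow> real \<Rightarrow> bool" where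
  "has_box_dim S d \<longleftrightarrow> upper_box_dim S = ereal d \<and> lower_box_dim S = ereal d"

text \<open>The normalising constant \<open>unit_ball_vol x\<close> is \<open>pi powr (x / 2) / Gamma (x / 2 + 1)\<close>, for real x.\<close>

definition minkowski_ratio :: "real \<Rightarrow> real \<Rightarrow> (real ^ 'n) set \<Rightarrow> ennreal" where
  "minkowski_ratio d \<epsilon> S =
     emeasure lebesgue (nbhd \<epsilon> S) /
     ennreal (unit_ball_vol (real CARD('n) - d) * \<epsilon> powr (real CARD('n) - d))"

definition upper_minkowski_content :: "real \<Rightarrow> (real ^ 'n) set \<Rightarrow> ennreal" where
  "upper_minkowski_content d S = Limsup (at_right 0) (\<lambda>\<epsilon>. minkowski_ratio d \<epsilon> S)"

definition lower_minkowski_content :: "real \<Rightarrow> (real ^ 'n) set \<Rightarrow> ennreal" where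
  "lower_minkowski_content d S = Liminf (at_right 0) (\<lambda>\<epsilon>. minkowski_ratio d \<epsilon> S)"

definition has_nondegenerate_box_dim :: "(real ^ 'n) set \<Rightarrow> real \<Rightarrow> bool" where
  "has_nondegenerate_box_dim S d \<longleftrightarrow>
     has_box_dim S d \<and> upper_minkowski_content d S < \<infinity> \<and> lower_minkowski_content d S > 0"

definition outer_nest :: "real \<Rightarrow> (real ^ 'n) set \<Rightarrow> (real ^ 'n) set" where
  "outer_nest \<alpha> S = (\<Union>k\<in>{1::nat..}. scaling (1 - real k powr (- \<alpha>)) S)"

end

theory Submission
  imports Defs "HOL-Library.Landau_Symbols"
begin

text \<open>For a bounded set, being Minkowski-non-degenerate of dimension \<open>d \<le> n\<close> amounts to the volume
  \<open>V(\<epsilon>)\<close> of its \<open>\<epsilon>\<close>-neighbourhood being of exact order \<open>\<epsilon> powr (n - d)\<close>; this order already determines the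
  box dimensions. So one has to show that passing from \<open>S\<close> to its nest multiplies the volume by
  the order of \<open>p = \<epsilon> powr (- 1 / (\<alpha> + 1))\<close>. Consecutive radii \<open>1 - k powr (- \<alpha>)\<close> differ by about \<open>\<alpha> * k powr (- \<alpha> - 1)\<close>,
  which exceeds \<open>2 * \<epsilon>\<close> as long as \<open>k\<close> is below a multiple of \<open>p\<close>; the neighbourhoods of these
  layers lie in disjoint annuli, and their volumes add up to the lower bound. The layers
  beyond \<open>k = p\<close> have radii within \<open>p * \<epsilon>\<close> of \<open>1\<close>, so up to an error \<open>\<epsilon>\<close> they consist of about \<open>p\<close> copies of \<open>S\<close>,
  which gives the upper bound. Comparison with the volume of a neighbourhood of the whole sphere shows \<open>d \<le> n - 1\<close>
  for \<open>S\<close>, so the dimension of the nest is at most \<open>n\<close> and the normalising constants are positive.\<close>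

section \<open>Neighbourhoods of bounded sets and their volume\<close>

definition tube_volume :: "(real ^ 'n) set \<Rightarrow> real \<Rightarrow> real" where
  "tube_volume S \<epsilon> = measure lebesgue (nbhd \<epsilon> S)"

lemma nbhd_eq_infdist: "S \<noteq> {} \<Longrightarrow> nbhd \<epsilon> S = {x. infdist x S \<le> \<epsilon>}"
  by (simp add: nbhd_def)

lemma nbhdI: "y \<in> S \<Longrightarrow> dist x y \<le> \<epsilon> \<Longrightarrow> x \<in> nbhd \<epsilon> S"
  by (auto simp: nbhd_def intro: infdist_le2)

text \<open>The infimum defining the distance need not be attained in \<open>S\<close>, so a witness
  exists only at a strictly larger distance. This is where the radii \<open>2 * \<epsilon>\<close>
  and \<open>\<epsilon> + e\<close> in later arguments come from.\<close>

lemma nbhdE: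
  assumes "x \<in> nbhd \<epsilon> S" "\<epsilon> < \<epsilon>'"
  obtains y where "y \<in> S" "dist x y < \<epsilon>'"
proof -
  have "S \<noteq> {}"
    using assms(1) by (simp add: nbhd_def)
  moreover from this have "(INF y\<in>S. dist x y) < \<epsilon>'"
    using assms by (simp add: nbhd_def infdist_notempty)
  moreover have "bdd_below ((\<lambda>y. dist x y) ` S)"
    by (rule bdd_belowI[of _ 0]) auto
  ultimately have "\<exists>y\<in>S. dist x y < \<epsilon>'"
    by (simp add: cINF_less_iff)
  then show ?thesis
    using that by blast
qed

lemma nbhd_mono: "S \<subseteq> T \<Longrightarrow> \<epsilon> \<le> \<epsilon>' \<Longrightarrow> nbhd \<epsilon> S \<subseteq> nbhd \<epsilon>' T"
  by (auto simp: nbhd_def dest: infdist_mono[of S T] intro: order_trans)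

lemma closed_nbhd: "closed (nbhd \<epsilon> S)"
proof (cases "S = {}")
  case False
  then show ?thesis
    unfolding nbhd_eq_infdist[OF False] by (intro closed_Collect_le continuous_intros)
qed (simp add: nbhd_def)

lemma bounded_nbhd:
  fixes S :: "(real ^ 'n) set"
  assumes "bounded S"
  shows "bounded (nbhd \<epsilon> S)"
proof -
  obtain B where B: "\<And>y. y \<in> S \<Longrightarrow> norm y \<le> B"
    using assms by (auto simp: bounded_iff)
  have "norm x \<le> B + (\<epsilon> + 1)" if x: "x \<in> nbhd \<epsilon> S" for x
  proof -
    obtain y where "y \<in> S" "dist x y < \<epsilon> + 1"
      using nbhdE[OF x, of "\<epsilon> + 1"] by auto
    then show ?thesis
      using B[of y] norm_triangle_sub[of x y] by (simp add: dist_norm)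
  qed
  then show ?thesis
    by (auto simp: bounded_iff)
qed

lemma lmeasurable_nbhd: "bounded S \<Longrightarrow> nbhd \<epsilon> S \<in> lmeasurable"
  by (simp add: lmeasurable_compact compact_eq_bounded_closed closed_nbhd bounded_nbhd)

lemma nbhd_sets [simp]: "nbhd \<epsilon> S \<in> sets lebesgue"
  by (simp add: borel_closed[OF closed_nbhd])

lemma tube_volume_nonneg [simp]: "0 \<le> tube_volume S \<epsilon>"
  by (simp add: tube_volume_def)

lemma tube_volume_mono:
  "bounded T \<Longrightarrow> S \<subseteq> T \<Longrightarrow> \<epsilon> \<le> \<epsilon>' \<Longrightarrow> tube_volume S \<epsilon> \<le> tube_volume T \<epsilon>'"
  unfolding tube_volume_def
  by (intro measure_mono_fmeasurable nbhd_mono lmeasurable_nbhd) auto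

lemma nbhd_scaling:
  assumes "0 < r"
  shows "nbhd \<epsilon> (scaling r S) = (*\<^sub>R) r ` nbhd (\<epsilon> / r) S"
proof (cases "S = {}")
  case False
  have inf: "infdist (r *\<^sub>R x) (scaling r S) = r * infdist x S" for x
  proof -
    have "infdist (r *\<^sub>R x) (scaling r S) = (INF y\<in>S. dist (r *\<^sub>R x) (r *\<^sub>R y))"
      using False by (simp add: infdist_def scaling_def image_image)
    also have "\<dots> = (INF y\<in>S. r * dist x y)"
      using assms by (simp add: dist_norm flip: scaleR_diff_right)
    \<comment> \<open>Multiplication by a positive \<open>r\<close> is monotone and continuous,
      hence commutes with the infimum of a nonempty set bounded below.\<close>
    also have "\<dots> = r * (INF y\<in>S. dist x y)"
    proof -
      have "mono ((*) r)"
        using assms by (auto intro!: monoI mult_left_mono)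
      moreover have "bdd_below ((\<lambda>y. dist x y) ` S)"
        by (rule bdd_belowI[of _ 0]) auto
      ultimately have "r * Inf ((\<lambda>y. dist x y) ` S) = (INF z\<in>(\<lambda>y. dist x y) ` S. r * z)"
        using False
        by (intro continuous_at_Inf_mono continuous_mult_left continuous_ident) simp_all
      then show ?thesis by (simp add: image_image)
    qed
    finally show ?thesis using False by (simp add: infdist_def)
  qed
  have S': "scaling r S \<noteq> {}"
    using False by (simp add: scaling_def)
  have "x \<in> (*\<^sub>R) r ` nbhd (\<epsilon> / r) S" if "x \<in> nbhd \<epsilon> (scaling r S)" for x
  proof
    show "x = r *\<^sub>R (inverse r *\<^sub>R x)" using assms by simp
    show "inverse r *\<^sub>R x \<in> nbhd (\<epsilon> / r) S"
      using that inf[of "inverse r *\<^sub>R x"] assms False S'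
      by (simp add: nbhd_eq_infdist field_simps)
  qed
  moreover have "r *\<^sub>R x \<in> nbhd \<epsilon> (scaling r S)" if "x \<in> nbhd (\<epsilon> / r) S" for x
    using that assms False S' by (simp add: nbhd_eq_infdist inf field_simps)
  ultimately show ?thesis by blast
qed (simp add: nbhd_def scaling_def)

lemma tube_volume_scaling:
  fixes S :: "(real ^ 'n) set"
  assumes "0 < r"
  shows "tube_volume (scaling r S) \<epsilon> = r ^ CARD('n) * tube_volume S (\<epsilon> / r)"
  using measure_lebesgue_affine[of r 0 "nbhd (\<epsilon> / r) S"] assms
  by (simp add: tube_volume_def nbhd_scaling)

section \<open>Tube volume and box counting\<close>

definition mesh_cube :: "real \<Rightarrow> ('n \<Rightarrow> int) \<Rightarrow> (real ^ 'n) set" where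
  "mesh_cube \<epsilon> m = cbox (\<chi> i. \<epsilon> * of_int (m i)) (\<chi> i. \<epsilon> * (of_int (m i) + 1))"

definition meeting_cubes :: "real \<Rightarrow> (real ^ 'n) set \<Rightarrow> ('n \<Rightarrow> int) set" where
  "meeting_cubes \<epsilon> S = {m. mesh_cube \<epsilon> m \<inter> S \<noteq> {}}"

lemma mem_mesh_cube:
  "x \<in> mesh_cube \<epsilon> m \<longleftrightarrow> (\<forall>i. \<epsilon> * of_int (m i) \<le> x $ i \<and> x $ i \<le> \<epsilon> * (of_int (m i) + 1))"
  by (simp add: mesh_cube_def mem_box_cart)

text \<open>The lowest corner of a cube lies in any cube containing it, which compares the index
  vectors coordinatewise. Injectivity allows index vectors to be counted in place of cubes.\<close>

lemma inj_mesh_cube: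
  assumes "0 < \<epsilon>"
  shows "inj (mesh_cube \<epsilon> :: ('n::finite \<Rightarrow> int) \<Rightarrow> (real ^ 'n) set)"
proof (rule injI)
  fix m m' :: "'n \<Rightarrow> int"
  assume eq: "mesh_cube \<epsilon> m = mesh_cube \<epsilon> m'"
  have le: "m' i \<le> m i" if "mesh_cube \<epsilon> m \<subseteq> mesh_cube \<epsilon> m'" for m m' :: "'n \<Rightarrow> int" and i
  proof -
    have "(\<chi> i. \<epsilon> * of_int (m i)) \<in> mesh_cube \<epsilon> m"
      using assms by (simp add: mem_mesh_cube)
    then have "(\<chi> i. \<epsilon> * of_int (m i)) \<in> mesh_cube \<epsilon> m'"
      using that by blast
    then show ?thesis
      using assms by (simp add: mem_mesh_cube)
  qed
  show "m = m'"
    using le[of m m'] le[of m' m] eq by (intro ext order.antisym) auto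
qed

lemma box_count_eq:
  assumes "0 < \<epsilon>"
  shows "box_count \<epsilon> S = card (meeting_cubes \<epsilon> S)"
proof -
  have "{Q \<in> mesh \<epsilon>. Q \<inter> S \<noteq> {}} = mesh_cube \<epsilon> ` meeting_cubes \<epsilon> S"
    by (auto simp: mesh_def meeting_cubes_def mesh_cube_def)
  then show ?thesis
    unfolding box_count_def by (simp add: card_image inj_on_subset[OF inj_mesh_cube[OF assms]])
qed

text \<open>Two points of a cube differ by at most \<open>\<epsilon>\<close> in each coordinate, and
  the sum of the coordinate differences dominates the Euclidean distance. The crude factor n is
  harmless for power orders.\<close>

lemma mesh_cube_subset_nbhd:
  fixes S :: "(real ^ 'n) set"
  assumes "0 < \<epsilon>" "m \<in> meeting_cubes \<epsilon> S"
  shows "mesh_cube \<epsilon> m \<subseteq> nbhd (real CARD('n) * \<epsilon>) S"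
proof
  fix x assume x: "x \<in> mesh_cube \<epsilon> m"
  obtain y where y: "y \<in> mesh_cube \<epsilon> m" "y \<in> S"
    using assms(2) by (auto simp: meeting_cubes_def)
  have "\<bar>(x - y) $ i\<bar> \<le> \<epsilon>" for i
  proof -
    have "\<epsilon> * of_int (m i) \<le> x $ i" "x $ i \<le> \<epsilon> * of_int (m i) + \<epsilon>"
        "\<epsilon> * of_int (m i) \<le> y $ i" "y $ i \<le> \<epsilon> * of_int (m i) + \<epsilon>"
      using x y(1) unfolding mem_mesh_cube by (simp_all add: distrib_left)
    then show ?thesis by simp
  qed
  then have "(\<Sum>i\<in>UNIV. \<bar>(x - y) $ i\<bar>) \<le> (\<Sum>i\<in>(UNIV :: 'n set). \<epsilon>)"
    by (rule sum_mono)
  with norm_le_l1_cart[of "x - y"] have "dist x y \<le> real CARD('n) * \<epsilon>"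
    by (simp add: dist_norm)
  then show "x \<in> nbhd (real CARD('n) * \<epsilon>) S"
    using y(2) by (rule nbhdI[rotated])
qed

lemma measure_cube_cart:
  fixes a :: "real ^ 'n"
  assumes "\<And>i. b $ i - a $ i = t" "0 \<le> t"
  shows "measure lebesgue (cbox a b) = t ^ CARD('n)"
proof -
  have "a $ i \<le> b $ i" for i using assms(1)[of i] assms(2) by simp
  then have "cbox a b \<noteq> {}"
    by (simp add: interval_ne_empty_cart)
  then show ?thesis
    by (simp add: content_cbox_cart assms)
qed

lemma measure_mesh_cube:
  "0 < \<epsilon> \<Longrightarrow> measure lebesgue (mesh_cube \<epsilon> m :: (real ^ 'n) set) = \<epsilon> ^ CARD('n)"
  unfolding mesh_cube_def by (intro measure_cube_cart) (simp_all add: algebra_simps)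

text \<open>Distinct cubes overlap in null sets, so their volumes add up inside the neighbourhood.
  An arbitrary finite family \<open>M\<close> is used because the finiteness of
  \<open>meeting_cubes\<close> is itself deduced from this bound.\<close>

lemma card_cubes_le:
  fixes S :: "(real ^ 'n) set"
  assumes "0 < \<epsilon>" "bounded S" "finite M" "M \<subseteq> meeting_cubes \<epsilon> S"
  shows "real (card M) * \<epsilon> ^ CARD('n) \<le> tube_volume S (real CARD('n) * \<epsilon>)"
proof -
  have negl: "negligible (mesh_cube \<epsilon> m \<inter> mesh_cube \<epsilon> m')" if "m \<noteq> m'" for m m' :: "'n \<Rightarrow> int"
  proof -
    obtain i where "m i \<noteq> m' i" using \<open>m \<noteq> m'\<close> by auto
    define j where "j = \<epsilon> * of_int (max (m i) (m' i))"
    \<comment> \<open>If the indices differ in coordinate \<open>i\<close>, the cubes can only touch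
      in the hyperplane through the larger of the two lower faces.\<close>
    have "mesh_cube \<epsilon> m \<inter> mesh_cube \<epsilon> m' \<subseteq> {x. x $ i = j}"
    proof clarify
      fix x assume x: "x \<in> mesh_cube \<epsilon> m" "x \<in> mesh_cube \<epsilon> m'"
      have "min (m i) (m' i) + 1 \<le> max (m i) (m' i)" using \<open>m i \<noteq> m' i\<close> by auto
      then have "\<epsilon> * (of_int (min (m i) (m' i)) + 1) \<le> j"
        unfolding j_def using assms(1) by (smt (verit) mult_le_cancel_left_pos of_int_1 of_int_add of_int_le_iff)
      moreover have "x $ i \<le> \<epsilon> * (of_int (min (m i) (m' i)) + 1)" "j \<le> x $ i"
        using x unfolding mem_mesh_cube j_def by (auto simp: min_def max_def)
      ultimately show "x $ i = j" by linarith
    qed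
    moreover have "negligible {x :: real ^ 'n. x $ i = j}"
      by (simp add: cart_eq_inner_axis negligible_standard_hyperplane)
    ultimately show ?thesis
      by (rule negligible_subset[rotated])
  qed
  have "real (card M) * \<epsilon> ^ CARD('n) = (\<Sum>m\<in>M. measure lebesgue (mesh_cube \<epsilon> m))"
    using assms(1) by (simp add: measure_mesh_cube)
  also have "\<dots> = measure lebesgue (\<Union>m\<in>M. mesh_cube \<epsilon> m)"
    using negl \<open>finite M\<close>
    by (intro measure_negligible_finite_Union_image[symmetric])
       (auto simp: pairwise_def mesh_cube_def)
  also have "\<dots> \<le> tube_volume S (real CARD('n) * \<epsilon>)"
    unfolding tube_volume_def using assms mesh_cube_subset_nbhd[of \<epsilon> _ S]
    by (intro measure_mono_fmeasurable lmeasurable_nbhd sets.finite_UN) (auto simp: mesh_cube_def)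
  finally show ?thesis .
qed

text \<open>The volume bounds the size of every finite subfamily uniformly. Since
  \<open>card\<close> is 0 on infinite sets, finiteness is what makes \<open>box_count\<close> a
  genuine count.\<close>

lemma finite_meeting_cubes:
  fixes S :: "(real ^ 'n) set"
  assumes "0 < \<epsilon>" "bounded S"
  shows "finite (meeting_cubes \<epsilon> S)"
proof (rule conjunct1[OF finite_if_finite_subsets_card_bdd])
  fix M assume M: "M \<subseteq> meeting_cubes \<epsilon> S" "finite M"
  have "real (card M) \<le> tube_volume S (real CARD('n) * \<epsilon>) / \<epsilon> ^ CARD('n)"
    using card_cubes_le[OF assms M(2,1)] assms(1) by (simp add: field_simps)
  then show "card M \<le> nat \<lfloor>tube_volume S (real CARD('n) * \<epsilon>) / \<epsilon> ^ CARD('n)\<rfloor>"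
    by (simp add: le_nat_floor)
qed

lemma box_count_le_tube_volume:
  fixes S :: "(real ^ 'n) set"
  assumes "0 < \<epsilon>" "bounded S"
  shows "real (box_count \<epsilon> S) * \<epsilon> ^ CARD('n) \<le> tube_volume S (real CARD('n) * \<epsilon>)"
  using card_cubes_le[OF assms finite_meeting_cubes[OF assms]]
  by (simp add: box_count_eq assms)

text \<open>A point of the neighbourhood is within \<open>2 * \<epsilon>\<close> of some point of
  \<open>S\<close>, so it lies in a meeting cube widened by \<open>2 * \<epsilon>\<close> on both
  sides. The widened cube has side \<open>5 * \<epsilon>\<close>.\<close>

lemma tube_volume_le_box_count:
  fixes S :: "(real ^ 'n) set"
  assumes "0 < \<epsilon>" "bounded S"
  shows "tube_volume S \<epsilon> \<le> real (box_count \<epsilon> S) * (5 * \<epsilon>) ^ CARD('n)"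
proof -
  define Q :: "('n \<Rightarrow> int) \<Rightarrow> (real ^ 'n) set" where
    "Q m = cbox (\<chi> i. \<epsilon> * of_int (m i) - 2 * \<epsilon>) (\<chi> i. \<epsilon> * of_int (m i) + 3 * \<epsilon>)" for m
  have "nbhd \<epsilon> S \<subseteq> (\<Union>m\<in>meeting_cubes \<epsilon> S. Q m)"
  proof
    fix x assume "x \<in> nbhd \<epsilon> S"
    then obtain y where y: "y \<in> S" "dist x y < 2 * \<epsilon>"
      using nbhdE[of x \<epsilon> S "2 * \<epsilon>"] assms(1) by auto
    define m where "m i = \<lfloor>y $ i / \<epsilon>\<rfloor>" for i
    have m: "\<epsilon> * of_int (m i) \<le> y $ i \<and> y $ i \<le> \<epsilon> * (of_int (m i) + 1)" for i
    proof -
      have "of_int (m i) \<le> y $ i / \<epsilon>" "y $ i / \<epsilon> \<le> of_int (m i) + 1"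
        unfolding m_def by linarith+
      then show ?thesis using assms(1) by (simp add: field_simps)
    qed
    then have "m \<in> meeting_cubes \<epsilon> S"
      using y(1) mem_mesh_cube[of y \<epsilon> m] by (auto simp: meeting_cubes_def)
    moreover have "\<bar>x $ i - y $ i\<bar> < 2 * \<epsilon>" for i
      using component_le_norm_cart[of "x - y" i] y(2) by (simp add: dist_norm)
    then have "x \<in> Q m"
      using m unfolding Q_def mem_box_cart by (simp add: algebra_simps) (smt (verit))
    ultimately show "x \<in> (\<Union>m\<in>meeting_cubes \<epsilon> S. Q m)" by blast
  qed
  then have "tube_volume S \<epsilon> \<le> measure lebesgue (\<Union>m\<in>meeting_cubes \<epsilon> S. Q m)"
    unfolding tube_volume_def using finite_meeting_cubes[OF assms]
    by (intro measure_mono_fmeasurable fmeasurable.finite_UN) (auto simp: Q_def)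
  also have "\<dots> \<le> (\<Sum>m\<in>meeting_cubes \<epsilon> S. measure lebesgue (Q m))"
    using finite_meeting_cubes[OF assms] by (intro measure_UNION_le) (auto simp: Q_def)
  finally have le: "tube_volume S \<epsilon> \<le> (\<Sum>m\<in>meeting_cubes \<epsilon> S. measure lebesgue (Q m))" .
  have "measure lebesgue (Q m) = (5 * \<epsilon>) ^ CARD('n)" for m
    unfolding Q_def using assms(1) by (intro measure_cube_cart) auto
  then have "(\<Sum>m\<in>meeting_cubes \<epsilon> S. measure lebesgue (Q m)) =
      real (box_count \<epsilon> S) * (5 * \<epsilon>) ^ CARD('n)"
    using assms(1) by (simp add: box_count_eq)
  with le show ?thesis by simp
qed

section \<open>Exact power orders at 0 and the box dimensions they determine\<close>

lemma bigtheta_powr_at_right_iff: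
  fixes f :: "real \<Rightarrow> real"
  assumes "\<And>\<epsilon>. 0 \<le> f \<epsilon>"
  shows "f \<in> \<Theta>[at_right 0](\<lambda>\<epsilon>. \<epsilon> powr e) \<longleftrightarrow>
    (\<exists>c>0. \<exists>C>0. \<forall>\<^sub>F \<epsilon> in at_right 0. c * \<epsilon> powr e \<le> f \<epsilon> \<and> f \<epsilon> \<le> C * \<epsilon> powr e)"
proof
  assume f: "f \<in> \<Theta>[at_right 0](\<lambda>\<epsilon>. \<epsilon> powr e)"
  from bigthetaD1[OF f] obtain C where
    C: "C > 0" "\<forall>\<^sub>F \<epsilon> in at_right 0. norm (f \<epsilon>) \<le> C * norm (\<epsilon> powr e)"
    by (elim landau_o.bigE)
  from bigthetaD2[OF f] obtain c where
    c: "c > 0" "\<forall>\<^sub>F \<epsilon> in at_right 0. norm (f \<epsilon>) \<ge> c * norm (\<epsilon> powr e)"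
    by (elim landau_omega.bigE)
  from C(2) c(2) have "\<forall>\<^sub>F \<epsilon> in at_right 0. c * \<epsilon> powr e \<le> f \<epsilon> \<and> f \<epsilon> \<le> C * \<epsilon> powr e"
    by eventually_elim (use assms in auto)
  with C(1) c(1) show "\<exists>c>0. \<exists>C>0. \<forall>\<^sub>F \<epsilon> in at_right 0. c * \<epsilon> powr e \<le> f \<epsilon> \<and> f \<epsilon> \<le> C * \<epsilon> powr e"
    by blast
next
  assume "\<exists>c>0. \<exists>C>0. \<forall>\<^sub>F \<epsilon> in at_right 0. c * \<epsilon> powr e \<le> f \<epsilon> \<and> f \<epsilon> \<le> C * \<epsilon> powr e"
  then obtain c C where c: "c > 0" "C > 0"
    and ev: "\<forall>\<^sub>F \<epsilon> in at_right 0. c * \<epsilon> powr e \<le> f \<epsilon> \<and> f \<epsilon> \<le> C * \<epsilon> powr e"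
    by blast
  show "f \<in> \<Theta>[at_right 0](\<lambda>\<epsilon>. \<epsilon> powr e)"
  proof (rule bigthetaI)
    show "f \<in> O[at_right 0](\<lambda>\<epsilon>. \<epsilon> powr e)"
      by (rule landau_o.bigI[OF c(2)], use ev in eventually_elim) (use assms in auto)
    show "f \<in> \<Omega>[at_right 0](\<lambda>\<epsilon>. \<epsilon> powr e)"
      by (rule landau_omega.bigI[OF c(1)], use ev in eventually_elim) (use assms in auto)
  qed
qed

lemma eventually_at_right_0_times:
  fixes a :: real
  assumes "\<forall>\<^sub>F \<epsilon> in at_right 0. P \<epsilon>" "0 < a"
  shows "\<forall>\<^sub>F \<epsilon> in at_right 0. P (a * \<epsilon>)"
proof -
  have "filterlim (\<lambda>\<epsilon>. a * \<epsilon>) (at_right 0) (at_right 0)"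
    by (rule filterlim_times_pos[OF filterlim_ident \<open>0 < a\<close>]) simp
  from filterlim_iff[THEN iffD1, OF this] assms(1) show ?thesis by blast
qed

lemma eventually_at_right_0_less: "0 < a \<Longrightarrow> \<forall>\<^sub>F \<epsilon> in at_right 0. 0 < \<epsilon> \<and> \<epsilon> < (a :: real)"
  by (auto simp: eventually_at_right_field)

lemma box_count_bigtheta:
  fixes S :: "(real ^ 'n) set"
  assumes "bounded S" "tube_volume S \<in> \<Theta>[at_right 0](\<lambda>\<epsilon>. \<epsilon> powr (real CARD('n) - d))"
  shows "(\<lambda>\<epsilon>. real (box_count \<epsilon> S)) \<in> \<Theta>[at_right 0](\<lambda>\<epsilon>. \<epsilon> powr (- d))"
proof -
  let ?n = "real CARD('n)"
  obtain c C where c: "0 < c" "0 < C"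
    and ev: "\<forall>\<^sub>F \<epsilon> in at_right 0. c * \<epsilon> powr (?n - d) \<le> tube_volume S \<epsilon> \<and>
      tube_volume S \<epsilon> \<le> C * \<epsilon> powr (?n - d)"
    using assms(2) by (subst (asm) bigtheta_powr_at_right_iff) auto
  \<comment> \<open>The power of 5 comes from the widened cubes in the lower bound, the power of n
    from evaluating the volume at radius \<open>?n * \<epsilon>\<close> in the upper one.\<close>
  define c' C' where "c' = c / 5 ^ CARD('n)" and "C' = C * ?n powr (?n - d)"
  have pos: "0 < c'" "0 < C'"
    using c by (simp_all add: c'_def C'_def)
  have "\<forall>\<^sub>F \<epsilon> in at_right 0. c' * \<epsilon> powr (- d) \<le> real (box_count \<epsilon> S) \<and>
      real (box_count \<epsilon> S) \<le> C' * \<epsilon> powr (- d)"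
    using ev eventually_at_right_0_times[OF ev, of ?n, simplified]
      eventually_at_right_0_less[of 1, simplified]
  proof eventually_elim
    case (elim \<epsilon>)
    have split: "\<epsilon> powr (?n - d) = \<epsilon> powr (- d) * \<epsilon> ^ CARD('n)"
      using elim powr_add[of \<epsilon> "- d" ?n] by (simp add: powr_realpow)
    have "c * \<epsilon> powr (?n - d) \<le> real (box_count \<epsilon> S) * (5 * \<epsilon>) ^ CARD('n)"
      using tube_volume_le_box_count[of \<epsilon> S] elim assms(1) by linarith
    then have "(c * \<epsilon> powr (- d)) * \<epsilon> ^ CARD('n) \<le> (real (box_count \<epsilon> S) * 5 ^ CARD('n)) * \<epsilon> ^ CARD('n)"
      by (simp only: split power_mult_distrib mult.assoc)
    then have "c * \<epsilon> powr (- d) \<le> real (box_count \<epsilon> S) * 5 ^ CARD('n)"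
      using elim by (simp only: mult_le_cancel_right_pos zero_less_power)
    then have lo: "c' * \<epsilon> powr (- d) \<le> real (box_count \<epsilon> S)"
      by (simp add: c'_def field_simps)
    have "real (box_count \<epsilon> S) * \<epsilon> ^ CARD('n) \<le> C * (?n * \<epsilon>) powr (?n - d)"
      using box_count_le_tube_volume[of \<epsilon> S] elim assms(1) by linarith
    also have "\<dots> = C' * \<epsilon> powr (- d) * \<epsilon> ^ CARD('n)"
      using elim by (simp add: C'_def powr_mult split)
    finally have "real (box_count \<epsilon> S) \<le> C' * \<epsilon> powr (- d)"
      using elim by simp
    with lo show ?case ..
  qed
  then show ?thesis
    using pos by (subst bigtheta_powr_at_right_iff) auto
qed

lemma tendsto_powr_at_right_0:
  "0 < a \<Longrightarrow> ((\<lambda>\<epsilon> :: real. \<epsilon> powr a) \<longlongrightarrow> 0) (at_right 0)"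
  using tendsto_powr'[of "\<lambda>\<epsilon> :: real. \<epsilon>" 0 "at_right 0" "\<lambda>_. a" a]
  by (auto simp: eventually_at_right_field gt_ex)

lemma filterlim_powr_at_right_0:
  assumes "a < 0"
  shows "filterlim (\<lambda>\<epsilon> :: real. \<epsilon> powr a) at_top (at_right 0)"
proof -
  have "filterlim (\<lambda>\<epsilon> :: real. inverse (\<epsilon> powr (- a))) at_top (at_right 0)"
    using tendsto_powr_at_right_0[of "- a"] assms
    by (intro filterlim_inverse_at_top) (auto simp: eventually_at_right_field intro!: exI[of _ 1])
  then show ?thesis by (simp add: powr_minus)
qed

lemma Inf_ereal_greaterThan: "Inf (ereal ` {d<..}) = ereal d"
proof (rule Inf_eqI)
  fix y assume "\<And>x. x \<in> ereal ` {d<..} \<Longrightarrow> y \<le> x"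
  then have "y \<le> ereal d + ereal e" if "0 < e" for e
    using that by simp
  then show "y \<le> ereal d" by (rule ereal_le_epsilon2)
qed auto

lemma Sup_ereal_lessThan: "Sup (ereal ` {..<d}) = ereal d"
proof (rule Sup_eqI)
  fix y assume y: "\<And>x. x \<in> ereal ` {..<d} \<Longrightarrow> x \<le> y"
  have "ereal d \<le> y + ereal e" if "0 < e" for e
    using y[of "ereal (d - e)"] that by (cases y) auto
  then show "ereal d \<le> y" by (rule ereal_le_epsilon2)
qed auto

text \<open>The product \<open>?f \<delta> \<epsilon>\<close> has the exact order
  \<open>\<epsilon> powr (\<delta> - d)\<close>, which tends to 0 iff \<open>d < \<delta>\<close>
  and to infinity iff \<open>\<delta> < d\<close>. The two sets of exponents are thus open
  half-lines ending at \<open>d\<close>.\<close>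

lemma has_box_dim_if_bigtheta:
  assumes "(\<lambda>\<epsilon>. real (box_count \<epsilon> S)) \<in> \<Theta>[at_right 0](\<lambda>\<epsilon>. \<epsilon> powr (- d))"
  shows "has_box_dim S d"
proof -
  let ?f = "\<lambda>\<delta> \<epsilon>. \<epsilon> powr \<delta> * real (box_count \<epsilon> S)"
  obtain c C where c: "0 < c" "0 < C"
    and ev: "\<forall>\<^sub>F \<epsilon> in at_right 0. c * \<epsilon> powr (- d) \<le> real (box_count \<epsilon> S) \<and>
      real (box_count \<epsilon> S) \<le> C * \<epsilon> powr (- d)"
    using assms by (subst (asm) bigtheta_powr_at_right_iff) auto
  have bnd: "\<forall>\<^sub>F \<epsilon> in at_right 0. c * \<epsilon> powr (\<delta> - d) \<le> ?f \<delta> \<epsilon> \<and> ?f \<delta> \<epsilon> \<le> C * \<epsilon> powr (\<delta> - d)" for \<delta>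
    using ev
  proof eventually_elim
    case (elim \<epsilon>)
    have "\<epsilon> powr \<delta> * (c * \<epsilon> powr (- d)) \<le> ?f \<delta> \<epsilon>" "?f \<delta> \<epsilon> \<le> \<epsilon> powr \<delta> * (C * \<epsilon> powr (- d))"
      using elim by (auto intro: mult_left_mono)
    moreover have "\<epsilon> powr (\<delta> - d) = \<epsilon> powr \<delta> * \<epsilon> powr (- d)"
      by (simp flip: powr_add)
    ultimately show ?case by (simp add: mult_ac)
  qed
  have "(?f \<delta> \<longlongrightarrow> 0) (at_right 0) \<longleftrightarrow> d < \<delta>" for \<delta>
  proof
    assume "d < \<delta>"
    then have "((\<lambda>\<epsilon>. C * \<epsilon> powr (\<delta> - d)) \<longlongrightarrow> C * 0) (at_right 0)"
      by (intro tendsto_mult_left tendsto_powr_at_right_0) simp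
    then have lim: "((\<lambda>\<epsilon>. C * \<epsilon> powr (\<delta> - d)) \<longlongrightarrow> 0) (at_right 0)"
      by simp
    have le: "\<forall>\<^sub>F \<epsilon> in at_right 0. ?f \<delta> \<epsilon> \<le> C * \<epsilon> powr (\<delta> - d)"
      using bnd[of \<delta>] by (rule eventually_mono) simp
    show "(?f \<delta> \<longlongrightarrow> 0) (at_right 0)"
      by (rule tendsto_sandwich[OF _ le tendsto_const lim]) simp
  next
    assume "(?f \<delta> \<longlongrightarrow> 0) (at_right 0)"
    from order_tendstoD(2)[OF this c(1)] have less: "\<forall>\<^sub>F \<epsilon> in at_right 0. ?f \<delta> \<epsilon> < c" .
    show "d < \<delta>"
    proof (rule ccontr)
      assume "\<not> d < \<delta>"
      have "\<forall>\<^sub>F \<epsilon> :: real in at_right 0. False"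
        using less bnd[of \<delta>] eventually_at_right_0_less[of 1, simplified]
      proof eventually_elim
        case (elim \<epsilon>)
        \<comment> \<open>A nonpositive exponent on a base in (0, 1) keeps the product above
          \<open>c\<close>, contradicting the limit 0.\<close>
        have "1 \<le> \<epsilon> powr (\<delta> - d)"
          using elim \<open>\<not> d < \<delta>\<close> powr_mono'[of "\<delta> - d" 0 \<epsilon>] by simp
        then have "c \<le> c * \<epsilon> powr (\<delta> - d)" using c(1) by simp
        with elim show ?case by linarith
      qed
      then show False by simp
    qed
  qed
  moreover have "filterlim (?f \<delta>) at_top (at_right 0) \<longleftrightarrow> \<delta> < d" for \<delta>
  proof
    assume "\<delta> < d"
    then have "filterlim (\<lambda>\<epsilon>. c * \<epsilon> powr (\<delta> - d)) at_top (at_right 0)"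
      using c(1) by (intro filterlim_tendsto_pos_mult_at_top[OF tendsto_const] filterlim_powr_at_right_0) auto
    then show "filterlim (?f \<delta>) at_top (at_right 0)"
      by (rule filterlim_at_top_mono) (rule eventually_mono[OF bnd[of \<delta>]], simp)
  next
    assume "filterlim (?f \<delta>) at_top (at_right 0)"
    then have greater: "\<forall>\<^sub>F \<epsilon> in at_right 0. C < ?f \<delta> \<epsilon>"
      by (simp add: filterlim_at_top_dense)
    show "\<delta> < d"
    proof (rule ccontr)
      assume "\<not> \<delta> < d"
      have "\<forall>\<^sub>F \<epsilon> :: real in at_right 0. False"
        using greater bnd[of \<delta>] eventually_at_right_0_less[of 1, simplified]
      proof eventually_elim
        case (elim \<epsilon>)
        have "\<epsilon> powr (\<delta> - d) \<le> 1"
          using elim \<open>\<not> \<delta> < d\<close> by (simp add: powr_le1)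
        then have "C * \<epsilon> powr (\<delta> - d) \<le> C" using c(2) by simp
        with elim show ?case by linarith
      qed
      then show False by simp
    qed
  qed
  ultimately show ?thesis
    by (simp add: has_box_dim_def upper_box_dim_def lower_box_dim_def
        Inf_ereal_greaterThan Sup_ereal_lessThan flip: greaterThan_def lessThan_def)
qed

section \<open>Minkowski content\<close>

text \<open>With \<open>d \<le> real CARD('n)\<close> and \<open>0 < \<epsilon>\<close> the
  normalising denominator is positive, so the extended division agrees with the real one.\<close>

lemma minkowski_ratio_eq:
  fixes S :: "(real ^ 'n) set"
  assumes "bounded S" "d \<le> real CARD('n)" "0 < \<epsilon>"
  shows "minkowski_ratio d \<epsilon> S =
    ennreal (tube_volume S \<epsilon> / (unit_ball_vol (real CARD('n) - d) * \<epsilon> powr (real CARD('n) - d)))"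
proof -
  have "emeasure lebesgue (nbhd \<epsilon> S) = ennreal (tube_volume S \<epsilon>)"
    using lmeasurable_nbhd[OF assms(1)] by (simp add: tube_volume_def emeasure_eq_measure2)
  then show ?thesis
    using assms by (simp add: minkowski_ratio_def divide_ennreal)
qed

text \<open>Dividing the sandwich for the volume by its power of \<open>\<epsilon>\<close> traps the
  ratio between two positive constants, which bound both contents. The box dimension follows from
  the same order through the box count.\<close>

lemma has_nondegenerate_box_dim_if_bigtheta:
  fixes S :: "(real ^ 'n) set"
  assumes "bounded S" "d \<le> real CARD('n)"
    and "tube_volume S \<in> \<Theta>[at_right 0](\<lambda>\<epsilon>. \<epsilon> powr (real CARD('n) - d))"
  shows "has_nondegenerate_box_dim S d"
proof -
  let ?e = "real CARD('n) - d"
  obtain c C where c: "0 < c" "0 < C"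
    and ev: "\<forall>\<^sub>F \<epsilon> in at_right 0. c * \<epsilon> powr ?e \<le> tube_volume S \<epsilon> \<and> tube_volume S \<epsilon> \<le> C * \<epsilon> powr ?e"
    using assms(3) by (subst (asm) bigtheta_powr_at_right_iff) auto
  define v where "v = unit_ball_vol ?e"
  have v: "0 < v" using assms(2) by (simp add: v_def)
  have "\<forall>\<^sub>F \<epsilon> in at_right 0. ennreal (c / v) \<le> minkowski_ratio d \<epsilon> S \<and>
      minkowski_ratio d \<epsilon> S \<le> ennreal (C / v)"
    using ev eventually_at_right_0_less[of 1, simplified]
    by eventually_elim
      (use assms v in \<open>auto simp: minkowski_ratio_eq field_simps simp flip: v_def intro!: ennreal_leI\<close>)
  then have "ennreal (c / v) \<le> lower_minkowski_content d S"
      "upper_minkowski_content d S \<le> ennreal (C / v)"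
    unfolding lower_minkowski_content_def upper_minkowski_content_def
    by (auto intro!: Liminf_bounded Limsup_bounded elim: eventually_mono)
  moreover have "0 < ennreal (c / v)" "ennreal (C / v) < \<infinity>"
    using c v by simp_all
  moreover have "has_box_dim S d"
    using has_box_dim_if_bigtheta[OF box_count_bigtheta[OF assms(1,3)]] .
  ultimately show ?thesis
    unfolding has_nondegenerate_box_dim_def by (metis order_less_le_trans order_le_less_trans)
qed

text \<open>Constants strictly beyond the contents bound the ratio for all small
  \<open>\<epsilon>\<close>, because strict inequalities against a limsup or liminf hold eventually.
  Multiplying by the denominator turns them into bounds for the volume.\<close>

lemma tube_volume_bigtheta_if_contents:
  fixes S :: "(real ^ 'n) set"
  assumes "bounded S" "d \<le> real CARD('n)"
    and "upper_minkowski_content d S < \<infinity>" "0 < lower_minkowski_content d S"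
  shows "tube_volume S \<in> \<Theta>[at_right 0](\<lambda>\<epsilon>. \<epsilon> powr (real CARD('n) - d))"
proof -
  let ?e = "real CARD('n) - d"
  define v where "v = unit_ball_vol ?e"
  have v: "0 < v" using assms(2) by (simp add: v_def)
  obtain C where C: "upper_minkowski_content d S < ennreal C" "0 < C"
  proof -
    obtain r where "upper_minkowski_content d S < of_nat r"
      using assms(3) by (metis ennreal_Ex_less_of_nat infinity_ennreal_def)
    then show ?thesis
      using that[of "real r"] by (cases "r = 0") (auto simp: ennreal_of_nat_eq_real_of_nat)
  qed
  obtain c where c: "ennreal c < lower_minkowski_content d S" "0 < c"
  proof -
    obtain a where a: "0 < a" "a < lower_minkowski_content d S"
      using dense[OF assms(4)] by blast
    then show ?thesis
      using that[of "enn2real a"] by (cases a) (auto simp: ennreal_enn2real_if)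
  qed
  have "\<forall>\<^sub>F \<epsilon> in at_right 0. ennreal c < minkowski_ratio d \<epsilon> S"
    using c(1) unfolding lower_minkowski_content_def by (rule less_LiminfD)
  moreover have "\<forall>\<^sub>F \<epsilon> in at_right 0. minkowski_ratio d \<epsilon> S < ennreal C"
    using C(1) unfolding upper_minkowski_content_def by (rule Limsup_lessD)
  ultimately have "\<forall>\<^sub>F \<epsilon> in at_right 0.
      (c * v) * \<epsilon> powr ?e \<le> tube_volume S \<epsilon> \<and> tube_volume S \<epsilon> \<le> (C * v) * \<epsilon> powr ?e"
    using eventually_at_right_0_less[of 1, simplified]
  proof eventually_elim
    case (elim \<epsilon>)
    define w where "w = v * \<epsilon> powr ?e"
    have w: "0 < w" using v elim by (simp add: w_def)
    have "c < tube_volume S \<epsilon> / w" "tube_volume S \<epsilon> / w < C"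
      using elim assms(1,2) c(2) C(2) w
      by (simp_all add: minkowski_ratio_eq ennreal_less_iff flip: v_def w_def)
    then show ?case
      using w by (simp add: field_simps w_def)
  qed
  moreover have "0 < c * v" "0 < C * v"
    using c(2) C(2) v by simp_all
  ultimately show ?thesis
    by (subst bigtheta_powr_at_right_iff) auto
qed

section \<open>Subsets of the sphere and their nests\<close>

text \<open>Every point of the layer has norm \<open>r\<close>, and the norm is 1-Lipschitz. The
  resulting annuli later separate the neighbourhoods of different layers.\<close>

lemma norm_nbhd_scaling_sphere:
  assumes "S \<subseteq> sphere 0 1" "0 \<le> r" "x \<in> nbhd \<epsilon> (scaling r S)"
  shows "\<bar>norm x - r\<bar> \<le> \<epsilon>"
proof (rule field_le_epsilon)
  fix e :: real assume "0 < e"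
  obtain y where "y \<in> scaling r S" "dist x y < \<epsilon> + e"
    using nbhdE[OF assms(3), of "\<epsilon> + e"] \<open>0 < e\<close> by auto
  then have "norm y = r" "norm (x - y) < \<epsilon> + e"
    using assms(1,2) by (auto simp: scaling_def dist_norm)
  then show "\<bar>norm x - r\<bar> \<le> \<epsilon> + e"
    using norm_triangle_ineq3[of x y] by linarith
qed

text \<open>The neighbourhood lies in the shell between the radii \<open>1 - \<epsilon>\<close> and
  \<open>1 + \<epsilon>\<close>, whose volume is of order \<open>\<epsilon>\<close>.\<close>

lemma tube_volume_subset_sphere_le:
  fixes S :: "(real ^ 'n) set"
  assumes "S \<subseteq> sphere 0 1" "0 < \<epsilon>" "\<epsilon> \<le> 1"
  shows "tube_volume S \<epsilon> \<le> unit_ball_vol CARD('n) * 2 ^ CARD('n) * CARD('n) * \<epsilon>"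
proof -
  let ?n = "CARD('n)"
  have "\<bar>norm x - 1\<bar> \<le> \<epsilon>" if "x \<in> nbhd \<epsilon> S" for x
    using norm_nbhd_scaling_sphere[OF assms(1), of 1 x \<epsilon>] that by (simp add: scaling_def)
  then have "nbhd \<epsilon> S \<subseteq> cball 0 (1 + \<epsilon>) - ball 0 (1 - \<epsilon>)"
    by force
  then have "tube_volume S \<epsilon> \<le> measure lebesgue (cball 0 (1 + \<epsilon>) - ball 0 (1 - \<epsilon>) :: (real ^ 'n) set)"
    unfolding tube_volume_def
    by (intro measure_mono_fmeasurable) (auto intro: lmeasurable_cball)
  also have "\<dots> = measure lebesgue (cball 0 (1 + \<epsilon>) :: (real ^ 'n) set)
      - measure lebesgue (ball 0 (1 - \<epsilon>) :: (real ^ 'n) set)"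
    using assms by (intro measurable_measure_Diff) auto
  also have "\<dots> = unit_ball_vol ?n * ((1 + \<epsilon>) ^ ?n - (1 - \<epsilon>) ^ ?n)"
    using assms by (simp add: content_cball content_ball algebra_simps)
  \<comment> \<open>Halving both bases brings them into the unit interval, as
    \<open>norm_power_diff\<close> demands; their difference is then
    \<open>\<epsilon>\<close>.\<close>
  also have "(1 + \<epsilon>) ^ ?n - (1 - \<epsilon>) ^ ?n = 2 ^ ?n * (((1 + \<epsilon>) / 2) ^ ?n - ((1 - \<epsilon>) / 2) ^ ?n)"
    by (simp add: field_simps)
  also have "((1 + \<epsilon>) / 2) ^ ?n - ((1 - \<epsilon>) / 2) ^ ?n \<le> ?n * \<epsilon>"
    using norm_power_diff[of "(1 + \<epsilon>) / 2" "(1 - \<epsilon>) / 2" ?n] assms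
    by (simp add: field_simps)
  finally show ?thesis by (simp add: mult_ac mult_left_mono)
qed

text \<open>The shell estimate bounds the box count by a constant times
  \<open>\<epsilon> powr (1 - n)\<close>. Hence no exponent above n - 1 makes the product in
  \<open>lower_box_dim\<close> tend to infinity.\<close>

lemma box_dim_subset_sphere_le:
  fixes S :: "(real ^ 'n) set"
  assumes "S \<subseteq> sphere 0 1" "has_box_dim S d"
  shows "d \<le> real CARD('n) - 1"
proof (rule ccontr)
  let ?n = "CARD('n)"
  assume "\<not> d \<le> real CARD('n) - 1"
  then have "ereal (real ?n - 1) < lower_box_dim S"
    using assms(2) by (simp add: has_box_dim_def)
  then obtain \<delta> where \<delta>: "real ?n - 1 < \<delta>"
    and lim: "filterlim (\<lambda>\<epsilon>. \<epsilon> powr \<delta> * real (box_count \<epsilon> S)) at_top (at_right 0)"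
    by (auto simp: lower_box_dim_def less_Sup_iff)
  \<comment> \<open>The last factor n arises because the shell estimate is applied at radius
    \<open>?n * \<epsilon>\<close>.\<close>
  define C where "C = unit_ball_vol ?n * 2 ^ ?n * ?n * ?n"
  have "bounded S"
    using assms(1) bounded_subset bounded_sphere by blast
  have "\<forall>\<^sub>F \<epsilon> in at_right 0. C < \<epsilon> powr \<delta> * real (box_count \<epsilon> S)"
    using lim by (simp add: filterlim_at_top_dense)
  then have "\<forall>\<^sub>F \<epsilon> :: real in at_right 0. False"
    using eventually_at_right_0_less[of "1 / ?n", simplified]
  proof eventually_elim
    case (elim \<epsilon>)
    have le: "?n * \<epsilon> \<le> 1" using elim by (simp add: field_simps)
    have "1 * \<epsilon> \<le> ?n * \<epsilon>" using elim by (intro mult_right_mono) auto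
    with le have "\<epsilon> \<le> 1" by simp
    have "C * \<epsilon> ^ ?n < (\<epsilon> powr \<delta> * real (box_count \<epsilon> S)) * \<epsilon> ^ ?n"
      using elim by simp
    also have "\<dots> \<le> \<epsilon> powr \<delta> * (C * \<epsilon>)"
      using box_count_le_tube_volume[of \<epsilon> S] tube_volume_subset_sphere_le[OF assms(1), of "?n * \<epsilon>"]
        elim le \<open>bounded S\<close> by (auto simp: C_def mult_ac intro!: mult_left_mono)
    also have "\<dots> = C * \<epsilon> powr (\<delta> + 1)"
      using elim by (simp add: powr_add)
    also have "\<dots> \<le> C * \<epsilon> powr ?n"
      using elim \<delta> \<open>\<epsilon> \<le> 1\<close> by (intro mult_left_mono powr_mono') (auto simp: C_def)
    finally show ?case using elim by (simp add: powr_realpow)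
  qed
  then show False by simp
qed

text \<open>Keeping the radii above a fixed \<open>\<rho>\<close> makes the comparison with
  \<open>S\<close> uniform in \<open>r\<close>; the factor \<open>r ^ CARD('n)\<close> is at most 1
  and is dropped.\<close>

lemma tube_volume_scaling_le:
  fixes S :: "(real ^ 'n) set"
  assumes "bounded S" "0 < \<rho>" "\<rho> \<le> r" "r \<le> 1" "0 < \<epsilon>"
  shows "tube_volume (scaling r S) \<epsilon> \<le> tube_volume S (\<epsilon> / \<rho>)"
proof -
  have "tube_volume (scaling r S) \<epsilon> = r ^ CARD('n) * tube_volume S (\<epsilon> / r)"
    using assms by (intro tube_volume_scaling) auto
  also have "\<dots> \<le> 1 * tube_volume S (\<epsilon> / \<rho>)"
    using assms by (intro mult_mono tube_volume_mono power_le_one divide_left_mono) auto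
  finally show ?thesis by simp
qed

lemma tube_volume_scaling_ge:
  fixes S :: "(real ^ 'n) set"
  assumes "bounded S" "0 < \<rho>" "\<rho> \<le> r" "r \<le> 1" "0 < \<epsilon>"
  shows "\<rho> ^ CARD('n) * tube_volume S \<epsilon> \<le> tube_volume (scaling r S) \<epsilon>"
proof -
  have "\<rho> ^ CARD('n) * tube_volume S \<epsilon> \<le> r ^ CARD('n) * tube_volume S (\<epsilon> / r)"
    using assms by (intro mult_mono tube_volume_mono power_mono) (auto simp: field_simps)
  also have "\<dots> = tube_volume (scaling r S) \<epsilon>"
    using assms by (intro tube_volume_scaling[symmetric]) auto
  finally show ?thesis .
qed

text \<open>The scaling formula divides by the radius, so radius 0 needs its own argument: a
  nonempty \<open>S\<close> collapses to the origin, and a ball there has the volume of a ball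
  around a point of \<open>S\<close>.\<close>

lemma tube_volume_scaling_zero_le:
  fixes S :: "(real ^ 'n) set"
  assumes "bounded S"
  shows "tube_volume (scaling 0 S) \<epsilon> \<le> tube_volume S \<epsilon>"
proof (cases "S = {}")
  case False
  then obtain s where s: "s \<in> S" by blast
  have "tube_volume (scaling 0 S) \<epsilon> = measure lebesgue (cball 0 \<epsilon> :: (real ^ 'n) set)"
    using False by (simp add: tube_volume_def nbhd_def scaling_def image_constant_conv cball_def dist_commute)
  also have "\<dots> = measure lebesgue (cball s \<epsilon>)"
    using content_cball_conv_ball content_ball_conv_unit_ball content_cball
    by (cases "0 \<le> \<epsilon>") (simp_all add: content_cball)
  also have "\<dots> = tube_volume {s} \<epsilon>"
    by (simp add: tube_volume_def nbhd_def cball_def dist_commute)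
  also have "\<dots> \<le> tube_volume S \<epsilon>"
    using assms s by (intro tube_volume_mono) auto
  finally show ?thesis .
qed (simp add: scaling_def)

lemma bounded_scaled: "bounded S \<Longrightarrow> bounded (scaling r S)"
  unfolding scaling_def by (rule bounded_scaling)

text \<open>The radius \<open>0\<close> has to be allowed because the first layer of the nest is \<open>{0}\<close>.\<close>

lemma tube_volume_le_if_covered:
  fixes S :: "(real ^ 'n) set"
  assumes "bounded S" "0 < \<rho>" "\<rho> \<le> 1" "0 < \<epsilon>"
    and "finite F" "F \<subseteq> insert 0 {\<rho>..1}"
    and cover: "\<And>y. y \<in> T \<Longrightarrow> \<exists>r\<in>F. \<exists>s\<in>S. dist y (r *\<^sub>R s) \<le> \<epsilon>"
  shows "tube_volume T \<epsilon> \<le> real (card F) * tube_volume S (3 * \<epsilon> / \<rho>)"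
proof -
  \<comment> \<open>The radius 3 is 2 for reaching a nearly nearest point of \<open>T\<close>, plus
    1 for the covering error.\<close>
  have "nbhd \<epsilon> T \<subseteq> (\<Union>r\<in>F. nbhd (3 * \<epsilon>) (scaling r S))"
  proof
    fix x assume "x \<in> nbhd \<epsilon> T"
    then obtain y where "y \<in> T" "dist x y < 2 * \<epsilon>"
      using nbhdE[of x \<epsilon> T "2 * \<epsilon>"] \<open>0 < \<epsilon>\<close> by auto
    moreover from cover[OF this(1)] obtain r s where "r \<in> F" "s \<in> S" "dist y (r *\<^sub>R s) \<le> \<epsilon>"
      by blast
    ultimately have "dist x (r *\<^sub>R s) \<le> 3 * \<epsilon>"
      using dist_triangle[of x "r *\<^sub>R s" y] by linarith
    moreover have "r *\<^sub>R s \<in> scaling r S"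
      using \<open>s \<in> S\<close> by (auto simp: scaling_def)
    ultimately show "x \<in> (\<Union>r\<in>F. nbhd (3 * \<epsilon>) (scaling r S))"
      using \<open>r \<in> F\<close> nbhdI by blast
  qed
  then have "tube_volume T \<epsilon> \<le> measure lebesgue (\<Union>r\<in>F. nbhd (3 * \<epsilon>) (scaling r S))"
    unfolding tube_volume_def using assms
    by (intro measure_mono_fmeasurable fmeasurable.finite_UN lmeasurable_nbhd bounded_scaled) auto
  also have "\<dots> \<le> (\<Sum>r\<in>F. tube_volume (scaling r S) (3 * \<epsilon>))"
    unfolding tube_volume_def using assms by (intro measure_UNION_le) auto
  also have "\<dots> \<le> (\<Sum>r\<in>F. tube_volume S (3 * \<epsilon> / \<rho>))"
  proof (rule sum_mono)
    fix r assume "r \<in> F"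
    then consider "r = 0" | "\<rho> \<le> r" "r \<le> 1" using assms(6) by fastforce
    then show "tube_volume (scaling r S) (3 * \<epsilon>) \<le> tube_volume S (3 * \<epsilon> / \<rho>)"
    proof cases
      case 1
      have "tube_volume (scaling 0 S) (3 * \<epsilon>) \<le> tube_volume S (3 * \<epsilon>)"
        using assms(1) by (rule tube_volume_scaling_zero_le)
      also have "\<dots> \<le> tube_volume S (3 * \<epsilon> / \<rho>)"
        using assms by (intro tube_volume_mono) (auto simp: field_simps)
      finally show ?thesis using 1 by simp
    next
      case 2
      then show ?thesis using assms by (intro tube_volume_scaling_le) auto
    qed
  qed
  finally show ?thesis by simp
qed

section \<open>Radii of the layers\<close>

definition nest_radius :: "real \<Rightarrow> nat \<Rightarrow> real" where
  "nest_radius \<alpha> k = 1 - real k powr (- \<alpha>)"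

lemma nest_radius_1 [simp]: "nest_radius \<alpha> (Suc 0) = 0"
  by (simp add: nest_radius_def)

lemma nest_radius_le_1: "nest_radius \<alpha> k \<le> 1"
  by (simp add: nest_radius_def)

lemma nest_radius_mono:
  "0 \<le> \<alpha> \<Longrightarrow> 1 \<le> i \<Longrightarrow> i \<le> j \<Longrightarrow> nest_radius \<alpha> i \<le> nest_radius \<alpha> j"
  by (simp add: nest_radius_def powr_mono2')

lemma nest_radius_2_pos: "0 < \<alpha> \<Longrightarrow> 0 < nest_radius \<alpha> 2"
  by (simp add: nest_radius_def powr_less_one)

lemma nest_radius_nonneg:
  assumes "0 \<le> \<alpha>" "1 \<le> k"
  shows "0 \<le> nest_radius \<alpha> k"
  using nest_radius_mono[of \<alpha> 1 k] assms by simp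

text \<open>The mean value theorem on \<open>[i, i + 1]\<close> gives the gap to the next radius,
  and the derivative is smallest in size at the right end, at most \<open>m\<close>. Monotonicity
  then covers every later \<open>j\<close>, so one bound separates all layers up to
  \<open>m\<close>.\<close>

lemma nest_radius_gap:
  assumes "0 < \<alpha>" "1 \<le> i" "i < j" "j \<le> m"
  shows "\<alpha> * real m powr (- \<alpha> - 1) \<le> nest_radius \<alpha> j - nest_radius \<alpha> i"
proof -
  have "((\<lambda>x. x powr (- \<alpha>)) has_real_derivative - \<alpha> * x powr (- \<alpha> - 1)) (at x)"
    if "real i \<le> x" for x
    using that assms by (intro has_real_derivative_powr) auto
  then obtain z where z: "real i < z" "z < real (Suc i)"
    and eq: "real (Suc i) powr (- \<alpha>) - real i powr (- \<alpha>) = (real (Suc i) - real i) * (- \<alpha> * z powr (- \<alpha> - 1))"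
    using MVT2[of "real i" "real (Suc i)" "\<lambda>x. x powr (- \<alpha>)" "\<lambda>z. - \<alpha> * z powr (- \<alpha> - 1)"] by auto
  have "\<alpha> * real m powr (- \<alpha> - 1) \<le> \<alpha> * z powr (- \<alpha> - 1)"
    using z assms by (intro mult_left_mono powr_mono2') auto
  also have "\<dots> = nest_radius \<alpha> (Suc i) - nest_radius \<alpha> i"
    using eq by (simp add: nest_radius_def)
  also have "\<dots> \<le> nest_radius \<alpha> j - nest_radius \<alpha> i"
    using nest_radius_mono[of \<alpha> "Suc i" j] assms by simp
  finally show ?thesis .
qed

section \<open>Volume of the neighbourhoods of the nest\<close>

lemma outer_nest_eq: "outer_nest \<alpha> S = (\<Union>k\<in>{1..}. scaling (nest_radius \<alpha> k) S)"
  by (simp add: outer_nest_def nest_radius_def)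

lemma bounded_outer_nest:
  assumes "S \<subseteq> sphere 0 1" "0 \<le> \<alpha>"
  shows "bounded (outer_nest \<alpha> S)"
proof -
  have "outer_nest \<alpha> S \<subseteq> cball 0 1"
    using assms nest_radius_nonneg[OF assms(2)] nest_radius_le_1[of \<alpha>]
    by (auto simp: outer_nest_eq scaling_def)
  then show ?thesis
    using bounded_cball bounded_subset by blast
qed

text \<open>The layers \<open>k \<le> K\<close> are kept; the radii of the remaining ones fill an interval of length at most
  \<open>K powr - \<alpha>\<close> and are rounded up to the grid \<open>1 - j * \<epsilon>\<close>. The choice of \<open>K\<close> balances the two counts.\<close>

lemma tube_volume_outer_nest_le:
  fixes S :: "(real ^ 'n) set"
  assumes "S \<subseteq> sphere 0 1" "0 < \<alpha>" "0 < \<epsilon>" "\<epsilon> \<le> 1"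
  shows "tube_volume (outer_nest \<alpha> S) \<epsilon>
    \<le> 4 * \<epsilon> powr (- (1 / (\<alpha> + 1))) * tube_volume S (3 * \<epsilon> / nest_radius \<alpha> 2)"
proof -
  define p \<rho> where "p = \<epsilon> powr (- (1 / (\<alpha> + 1)))" and "\<rho> = nest_radius \<alpha> 2"
  have \<rho>: "0 < \<rho>" "\<rho> \<le> 1"
    using assms(2) by (simp_all add: \<rho>_def nest_radius_2_pos nest_radius_le_1)
  have p: "1 \<le> p"
    using assms powr_mono'[of "- (1 / (\<alpha> + 1))" 0 \<epsilon>] by (simp add: p_def)
  define K where "K = nat \<lceil>p\<rceil>"
  have K: "p \<le> real K" "real K \<le> p + 1" "1 \<le> K"
    using p unfolding K_def by linarith+
  define J where "J = nat \<lfloor>p\<rfloor>"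
  have J: "real J \<le> p"
    using p by (simp add: J_def)
  have "bounded S"
    using assms(1) bounded_subset bounded_sphere by blast
  \<comment> \<open>Intersecting the grid with \<open>{\<rho>..1}\<close> keeps the radii where the
    scaling estimate is uniform. No grid point used below is lost, since the radii are rounded
    up.\<close>
  define F where "F = nest_radius \<alpha> ` {1..K} \<union> ((\<lambda>j. 1 - real j * \<epsilon>) ` {..J} \<inter> {\<rho>..1})"
  have "finite F" by (simp add: F_def)
  have F: "F \<subseteq> insert 0 {\<rho>..1}"
  proof -
    have "nest_radius \<alpha> k \<in> insert 0 {\<rho>..1}" if "1 \<le> k" for k
    proof (cases "k = 1")
      case False
      then show ?thesis
        using nest_radius_mono[of \<alpha> 2 k] that assms(2) by (simp add: \<rho>_def nest_radius_le_1)
    qed simp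
    then have "nest_radius \<alpha> ` {1..K} \<subseteq> insert 0 {\<rho>..1}"
      by (intro image_subsetI) simp
    then show ?thesis unfolding F_def by blast
  qed
  \<comment> \<open>The count is at most \<open>K + (J + 1) \<le> 2 * p + 2\<close>, and
    \<open>1 \<le> p\<close> absorbs the constant.\<close>
  have "card F \<le> card (nest_radius \<alpha> ` {1..K}) + card ((\<lambda>j. 1 - real j * \<epsilon>) ` {..J} \<inter> {\<rho>..1})"
    unfolding F_def by (rule card_Un_le)
  also have "\<dots> \<le> card {1..K} + card {..J}"
    by (intro add_mono card_image_le order_trans[OF card_mono card_image_le]) auto
  finally have card: "real (card F) \<le> 4 * p"
    using K J p by simp
  have "real K powr (- \<alpha>) \<le> p powr (- \<alpha>)"
    using K p assms(2) by (intro powr_mono2') auto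
  \<comment> \<open>This identity characterises the balance: the tail of the radii has length
    \<open>p * \<epsilon>\<close>, so about \<open>p\<close> grid steps suffice for it, as many as
    there are kept layers.\<close>
  also have "p powr (- \<alpha>) = p * \<epsilon>"
  proof -
    have "- (1 / (\<alpha> + 1)) * (- \<alpha>) = - (1 / (\<alpha> + 1)) + 1"
      using assms(2) by (simp add: field_simps)
    then show ?thesis
      using assms(3) powr_add[of \<epsilon> "- (1 / (\<alpha> + 1))" 1] by (simp add: p_def powr_powr)
  qed
  finally have tail: "real K powr (- \<alpha>) \<le> p * \<epsilon>" .
  have "tube_volume (outer_nest \<alpha> S) \<epsilon> \<le> real (card F) * tube_volume S (3 * \<epsilon> / \<rho>)"
  proof (rule tube_volume_le_if_covered[OF \<open>bounded S\<close> \<rho> assms(3) \<open>finite F\<close> F])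
    fix y assume "y \<in> outer_nest \<alpha> S"
    then obtain k s where k: "1 \<le> k" and s: "s \<in> S" and y: "y = nest_radius \<alpha> k *\<^sub>R s"
      by (auto simp: outer_nest_eq scaling_def)
    have "\<exists>r\<in>F. \<bar>nest_radius \<alpha> k - r\<bar> \<le> \<epsilon>"
    proof (cases "k \<le> K")
      case True
      then show ?thesis
        using k assms(3) by (intro bexI[of _ "nest_radius \<alpha> k"]) (auto simp: F_def)
    next
      case False
      define t where "t = real k powr (- \<alpha>) / \<epsilon>"
      have "real k powr (- \<alpha>) \<le> real K powr (- \<alpha>)"
        using False K assms(2) by (intro powr_mono2') auto
      with tail have t: "0 \<le> t" "t \<le> p"
        using assms(3) by (simp_all add: t_def field_simps)
      \<comment> \<open>Rounding \<open>t\<close> down moves the radius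
        \<open>1 - t * \<epsilon>\<close> up by at most \<open>\<epsilon>\<close>, so it stays above
        \<open>\<rho>\<close>.\<close>
      define j where "j = nat \<lfloor>t\<rfloor>"
      have j: "real j \<le> t" "t \<le> real j + 1"
        using t unfolding j_def by linarith+
      have jJ: "j \<le> J"
        unfolding j_def J_def using t by (intro nat_mono floor_mono) auto
      have rad: "nest_radius \<alpha> k = 1 - t * \<epsilon>"
        using assms(3) by (simp add: nest_radius_def t_def)
      have 1: "real j * \<epsilon> \<le> t * \<epsilon>" "t * \<epsilon> \<le> real j * \<epsilon> + \<epsilon>"
        using j assms(3) mult_right_mono[OF j(2), of \<epsilon>] by (simp_all add: distrib_right mult_right_mono)
      have "2 \<le> k" using False K(3) by simp
      then have "\<rho> \<le> nest_radius \<alpha> k"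
        using assms(2) by (simp add: \<rho>_def nest_radius_mono)
      then have "\<rho> \<le> 1 - real j * \<epsilon>"
        using 1(1) rad by linarith
      then have "1 - real j * \<epsilon> \<in> F"
        unfolding F_def using jJ assms(3) by simp
      moreover have "\<bar>nest_radius \<alpha> k - (1 - real j * \<epsilon>)\<bar> \<le> \<epsilon>"
        using 1 rad by simp
      ultimately show ?thesis by blast
    qed
    then obtain r where r: "r \<in> F" "\<bar>nest_radius \<alpha> k - r\<bar> \<le> \<epsilon>" by blast
    have "dist y (r *\<^sub>R s) = \<bar>nest_radius \<alpha> k - r\<bar> * norm s"
      by (simp add: y dist_norm flip: scaleR_diff_left)
    also have "norm s = 1" using s assms(1) by auto
    finally have "dist y (r *\<^sub>R s) \<le> \<epsilon>"
      using r(2) by simp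
    then show "\<exists>r\<in>F. \<exists>s\<in>S. dist y (r *\<^sub>R s) \<le> \<epsilon>"
      using r(1) s by blast
  qed
  also have "\<dots> \<le> 4 * p * tube_volume S (3 * \<epsilon> / \<rho>)"
    using card by (intro mult_right_mono) auto
  finally show ?thesis by (simp add: p_def \<rho>_def)
qed

text \<open>Up to index \<open>m\<close> the radii are more than \<open>2 * \<epsilon>\<close>
  apart, so the neighbourhoods of the layers are disjoint and their volumes add. The first layer has
  radius 0 and is left out, which leaves \<open>m - 1\<close> layers with radius at least
  \<open>nest_radius \<alpha> 2\<close>.\<close>

lemma tube_volume_outer_nest_ge:
  fixes S :: "(real ^ 'n) set"
  assumes "S \<subseteq> sphere 0 1" "0 < \<alpha>" "0 < \<epsilon>" "2 * \<epsilon> < \<alpha> * real m powr (- \<alpha> - 1)"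
  shows "(real m - 1) * nest_radius \<alpha> 2 ^ CARD('n) * tube_volume S \<epsilon> \<le> tube_volume (outer_nest \<alpha> S) \<epsilon>"
proof -
  define \<rho> where "\<rho> = nest_radius \<alpha> 2"
  let ?N = "\<lambda>k. nbhd \<epsilon> (scaling (nest_radius \<alpha> k) S)"
  have \<rho>: "0 < \<rho>" using assms(2) by (simp add: \<rho>_def nest_radius_2_pos)
  have bounded: "bounded S"
    using assms(1) bounded_subset bounded_sphere by blast
  have disj: "?N i \<inter> ?N j = {}" if "2 \<le> i" "i < j" "j \<le> m" for i j
  proof -
    have "2 * \<epsilon> < nest_radius \<alpha> j - nest_radius \<alpha> i"
      using nest_radius_gap[of \<alpha> i j m] that assms by simp
    moreover have "\<bar>norm x - nest_radius \<alpha> i\<bar> \<le> \<epsilon>" if "x \<in> ?N i" for x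
      using norm_nbhd_scaling_sphere[OF assms(1) _ that] \<open>2 \<le> i\<close> assms(2)
      by (simp add: nest_radius_nonneg)
    moreover have "\<bar>norm x - nest_radius \<alpha> j\<bar> \<le> \<epsilon>" if "x \<in> ?N j" for x
      using norm_nbhd_scaling_sphere[OF assms(1) _ that] \<open>2 \<le> i\<close> \<open>i < j\<close> assms(2)
      by (simp add: nest_radius_nonneg)
    ultimately show ?thesis by fastforce
  qed
  \<comment> \<open>Equality may fail here: for \<open>m = 0\<close> the left factor is -1 while the
    interval is empty.\<close>
  have "(real m - 1) * (\<rho> ^ CARD('n) * tube_volume S \<epsilon>) \<le> real (card {2..m}) * (\<rho> ^ CARD('n) * tube_volume S \<epsilon>)"
    using \<rho> by (intro mult_right_mono) auto
  also have "\<dots> = (\<Sum>k\<in>{2..m}. \<rho> ^ CARD('n) * tube_volume S \<epsilon>)"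
    by simp
  also have "\<dots> \<le> (\<Sum>k\<in>{2..m}. measure lebesgue (?N k))"
    using bounded \<rho> assms(2,3)
    by (intro sum_mono tube_volume_scaling_ge[unfolded tube_volume_def[of "scaling _ _"]])
      (auto simp: \<rho>_def nest_radius_mono nest_radius_le_1)
  also have "\<dots> = measure lebesgue (\<Union>k\<in>{2..m}. ?N k)"
  proof (rule measure_finite_Union[symmetric])
    show "disjoint_family_on ?N {2..m}"
      unfolding disjoint_family_on_def using disj by (metis Int_commute atLeastAtMost_iff nat_neq_iff)
    show "emeasure lebesgue (?N k) \<noteq> \<infinity>" for k
      using lmeasurable_nbhd[OF bounded_scaled[OF bounded]] by (metis fmeasurableD2 infinity_ennreal_def)
  qed auto
  also have "\<dots> \<le> tube_volume (outer_nest \<alpha> S) \<epsilon>"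
  proof -
    have "scaling (nest_radius \<alpha> k) S \<subseteq> outer_nest \<alpha> S" if "k \<in> {2..m}" for k
      unfolding outer_nest_eq using that by (intro UN_upper) auto
    then show ?thesis
      unfolding tube_volume_def using bounded_outer_nest[OF assms(1)] assms(2)
      by (intro measure_mono_fmeasurable lmeasurable_nbhd UN_least nbhd_mono) auto
  qed
  finally show ?thesis by (simp add: \<rho>_def mult.assoc)
qed

lemma tube_volume_outer_nest_bigtheta:
  fixes S :: "(real ^ 'n) set"
  assumes "S \<subseteq> sphere 0 1" "0 < \<alpha>"
    and "tube_volume S \<in> \<Theta>[at_right 0](\<lambda>\<epsilon>. \<epsilon> powr e)"
  shows "tube_volume (outer_nest \<alpha> S) \<in> \<Theta>[at_right 0](\<lambda>\<epsilon>. \<epsilon> powr (e - 1 / (\<alpha> + 1)))"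
proof -
  \<comment> \<open>The factor \<open>q\<close> is chosen so that
    \<open>x = q * \<epsilon> powr (- \<beta>)\<close> solves
    \<open>\<alpha> * x powr (- \<alpha> - 1) = 2 * \<epsilon>\<close>, the threshold up to which
    the layers are known to be separated.\<close>
  define \<beta> \<rho> q where "\<beta> = 1 / (\<alpha> + 1)" and "\<rho> = nest_radius \<alpha> 2" and "q = (\<alpha> / 2) powr \<beta>"
  have \<rho>: "0 < \<rho>" using assms(2) by (simp add: \<rho>_def nest_radius_2_pos)
  have \<beta>: "0 < \<beta>" using assms(2) by (simp add: \<beta>_def)
  have q: "0 < q" using assms(2) by (simp add: q_def)
  obtain c C where c: "0 < c" "0 < C"
    and ev: "\<forall>\<^sub>F \<epsilon> in at_right 0. c * \<epsilon> powr e \<le> tube_volume S \<epsilon> \<and> tube_volume S \<epsilon> \<le> C * \<epsilon> powr e"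
    using assms(3) by (subst (asm) bigtheta_powr_at_right_iff) auto
  \<comment> \<open>The half in \<open>c'\<close> comes from \<open>x / 2 \<le> real m - 1\<close>;
    the power of \<open>3 / \<rho>\<close> in \<open>C'\<close> from evaluating the volume of
    \<open>S\<close> at the enlarged radius.\<close>
  define c' C' where "c' = q / 2 * \<rho> ^ CARD('n) * c" and "C' = 4 * C * (3 / \<rho>) powr e"
  have pos: "0 < c'" "0 < C'"
    using c \<rho> q by (simp_all add: c'_def C'_def)
  have large: "\<forall>\<^sub>F \<epsilon> in at_right 0. 4 \<le> q * \<epsilon> powr (- \<beta>)"
    using filterlim_tendsto_pos_mult_at_top[OF tendsto_const q filterlim_powr_at_right_0[of "- \<beta>"]] \<beta>
    by (simp add: filterlim_at_top)
  have "\<forall>\<^sub>F \<epsilon> in at_right 0. c' * \<epsilon> powr (e - \<beta>) \<le> tube_volume (outer_nest \<alpha> S) \<epsilon> \<and>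
      tube_volume (outer_nest \<alpha> S) \<epsilon> \<le> C' * \<epsilon> powr (e - \<beta>)"
    using ev eventually_at_right_0_times[OF ev, of "3 / \<rho>", OF divide_pos_pos[OF _ \<rho>], simplified]
      eventually_at_right_0_less[of 1, simplified] large
  proof eventually_elim
    case (elim \<epsilon>)
    have split: "\<epsilon> powr (e - \<beta>) = \<epsilon> powr (- \<beta>) * \<epsilon> powr e"
      by (simp flip: powr_add)
    have "tube_volume (outer_nest \<alpha> S) \<epsilon> \<le> 4 * \<epsilon> powr (- \<beta>) * tube_volume S (3 / \<rho> * \<epsilon>)"
      using tube_volume_outer_nest_le[OF assms(1,2), of \<epsilon>] elim by (simp add: \<beta>_def \<rho>_def)
    also have "\<dots> \<le> 4 * \<epsilon> powr (- \<beta>) * (C * (3 / \<rho> * \<epsilon>) powr e)"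
      using elim by (intro mult_left_mono) auto
    also have "(3 / \<rho> * \<epsilon>) powr e = (3 / \<rho>) powr e * \<epsilon> powr e"
      by (rule powr_mult)
    finally have upper: "tube_volume (outer_nest \<alpha> S) \<epsilon> \<le> C' * \<epsilon> powr (e - \<beta>)"
      by (simp add: split C'_def mult_ac)
    define x where "x = q * \<epsilon> powr (- \<beta>)"
    have x: "4 \<le> x" using elim by (simp add: x_def)
    \<comment> \<open>The largest integer strictly below \<open>x\<close>: strictness yields the
      strict gap, and \<open>4 \<le> x\<close> gives
      \<open>real m - 1 \<ge> x - 2 \<ge> x / 2\<close>.\<close>
    define m where "m = nat (\<lceil>x\<rceil> - 1)"
    have m: "real m < x" "x - 1 \<le> real m" "0 < m"
      using x unfolding m_def by linarith+
    have "x powr (- \<alpha> - 1) = 2 * \<epsilon> / \<alpha>"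
    proof -
      have exps: "\<beta> * (- \<alpha> - 1) = - 1" "- \<beta> * (- \<alpha> - 1) = 1"
        using assms(2) by (simp_all add: \<beta>_def field_simps)
      have "((\<alpha> / 2) powr \<beta>) powr (- \<alpha> - 1) = 2 / \<alpha>"
        unfolding powr_powr exps using assms(2) by (simp add: powr_minus)
      moreover have "(\<epsilon> powr (- \<beta>)) powr (- \<alpha> - 1) = \<epsilon>"
        unfolding powr_powr exps using elim by simp
      ultimately show ?thesis
        unfolding x_def q_def powr_mult by simp
    qed
    moreover have "x powr (- \<alpha> - 1) < real m powr (- \<alpha> - 1)"
      using m assms(2) by (intro powr_less_mono2_neg) auto
    ultimately have gap: "2 * \<epsilon> < \<alpha> * real m powr (- \<alpha> - 1)"
      using mult_strict_left_mono[of "x powr (- \<alpha> - 1)" "real m powr (- \<alpha> - 1)" \<alpha>] assms(2) by simp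
    have "c' * \<epsilon> powr (e - \<beta>) = x / 2 * \<rho> ^ CARD('n) * (c * \<epsilon> powr e)"
      by (simp add: split c'_def x_def)
    also have "\<dots> \<le> (real m - 1) * \<rho> ^ CARD('n) * tube_volume S \<epsilon>"
      using elim m x \<rho> c by (intro mult_mono) auto
    also have "\<dots> \<le> tube_volume (outer_nest \<alpha> S) \<epsilon>"
      unfolding \<rho>_def using tube_volume_outer_nest_ge[OF assms(1,2) _ gap] elim by simp
    finally show ?case using upper by blast
  qed
  then show ?thesis
    unfolding \<beta>_def using pos by (subst bigtheta_powr_at_right_iff) auto
qed

theorem theorem2:
  fixes S :: "(real ^ 'n) set" and \<delta> \<alpha> :: real
  assumes "S \<in> sets borel"
    and "S \<subseteq> sphere 0 1"
    and "\<delta> \<ge> 0"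
    and "has_nondegenerate_box_dim S \<delta>"
    and "\<alpha> > 0"
  shows "has_nondegenerate_box_dim (outer_nest \<alpha> S) (\<delta> + 1 / (\<alpha> + 1))"
proof -
  have \<delta>: "\<delta> \<le> real CARD('n) - 1"
    using assms(2,4) by (intro box_dim_subset_sphere_le) (auto simp: has_nondegenerate_box_dim_def)
  have "bounded S"
    using assms(2) bounded_subset bounded_sphere by blast
  then have "tube_volume S \<in> \<Theta>[at_right 0](\<lambda>\<epsilon>. \<epsilon> powr (real CARD('n) - \<delta>))"
    using assms(4) \<delta> by (intro tube_volume_bigtheta_if_contents) (auto simp: has_nondegenerate_box_dim_def)
  from tube_volume_outer_nest_bigtheta[OF assms(2,5) this]
  have "tube_volume (outer_nest \<alpha> S) \<in>
      \<Theta>[at_right 0](\<lambda>\<epsilon>. \<epsilon> powr (real CARD('n) - (\<delta> + 1 / (\<alpha> + 1))))"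
    by (simp add: diff_diff_eq)
  \<comment> \<open>The nest adds at most the one dimension that a subset of the sphere leaves free,
    so the new exponent is at most n.\<close>
  moreover have "1 / (\<alpha> + 1) \<le> 1"
    using assms(5) by simp
  then have "\<delta> + 1 / (\<alpha> + 1) \<le> real CARD('n)"
    using \<delta> by linarith
  ultimately show ?thesis
    using bounded_outer_nest[OF assms(2)] assms(5)
    by (intro has_nondegenerate_box_dim_if_bigtheta) auto
qed

end
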